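(* There are no non-trivial protoadditive reflections of the category $\mathsf{Grp}$ of groups. That is, if $\mathsf{X}$ is a full replete reflective subcategory of $\mathsf{Grp}$ whose reflection $F:\mathsf{Grp}\to\mathsf{X}$ (the left adjoint of the inclusion) is protoadditive, then either $\mathsf{X}=\mathsf{Grp}$ or $\mathsf{X}$ consists of trivial groups.
   Context: A short exact sequence $0\to K\xrightarrow{k}A\xrightarrow{f}B\to0$ in a pointed category is a pair with $k=\ker(f)$ and $f=\operatorname{coker}(k)$ in that category; it is split if a morphism $s:B\to A$ with $fs=1_B$ is given. A reflection $F:\mathsf{C}\to\mathsf{X}$ onto a full replete subcategory is protoadditive if, for every split short exact sequence $0\to K\xrightarrow{k}A\underset{s}{\overset{f}{\rightleftarrows}}B\to0$ in $\mathsf{C}$, the sequence $0\to F(K)\xrightarrow{F(k)}F(A)\xrightarrow{F(f)}F(B)\to0$ (split by $F(s)$) is a short exact sequence in $\mathsf{X}$. *)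

theory Defs
  imports "HOL-Algebra.Elementary_Groups" "HOL-Library.FuncSet"
begin

unbundle cardinal_syntax

text \<open>
  The category of groups is taken relative to a size bound: \<open>Grp \<kappa>\<close> consists of the groups
  carried by a subset of \<open>'a\<close> of cardinality less than \<open>\<kappa>\<close>.  If \<open>\<kappa>\<close> is at most the cardinal
  successor of the cardinality of \<open>'a\<close>, then every group of cardinality less than \<open>\<kappa>\<close>, over any
  type, has an isomorphic copy here.  For inaccessible \<open>\<kappa>\<close> this is, up to equivalence, the category
  of groups of a Grothendieck universe; if \<open>\<kappa>\<close> is that successor, it is the category of all groups
  over \<open>'a\<close>.

  Full subcategories of it are given by their classes of objects.
\<close>

definition Grp :: "'k rel \<Rightarrow> 'a monoid set" where
  "Grp \<kappa> = {G. group G \<and> |carrier G| <o \<kappa>}"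

text \<open>
  Library homomorphisms are arbitrary outside the carrier of the domain.  Morphisms are made
  extensional, so that equality of functions is equality of morphisms.
\<close>

definition Hom :: "'a monoid \<Rightarrow> 'a monoid \<Rightarrow> ('a \<Rightarrow> 'a) set" where
  "Hom G H = hom G H \<inter> extensional (carrier G)"

definition idm :: "'a monoid \<Rightarrow> 'a \<Rightarrow> 'a" where
  "idm G = (\<lambda>x\<in>carrier G. x)"

text \<open>Composite of \<open>f\<close> with domain \<open>G\<close>, followed by \<open>g\<close>.\<close>

definition compm :: "'a monoid \<Rightarrow> ('a \<Rightarrow> 'a) \<Rightarrow> ('a \<Rightarrow> 'a) \<Rightarrow> 'a \<Rightarrow> 'a" where
  "compm G g f = compose (carrier G) g f"

text \<open>
  In a pointed full subcategory of groups the zero object is a trivial group (its identity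
  coincides with the constant endomorphism), so the zero morphisms are the constant ones.
\<close>

definition zerom :: "'a monoid \<Rightarrow> 'a monoid \<Rightarrow> 'a \<Rightarrow> 'a" where
  "zerom G H = (\<lambda>x\<in>carrier G. \<one>\<^bsub>H\<^esub>)"

text \<open>Kernels and cokernels in the full subcategory on a class \<open>C\<close> of groups.\<close>

definition is_kernel ::
  "'a monoid set \<Rightarrow> 'a monoid \<Rightarrow> ('a \<Rightarrow> 'a) \<Rightarrow> 'a monoid \<Rightarrow> ('a \<Rightarrow> 'a) \<Rightarrow> 'a monoid \<Rightarrow> bool" where
  "is_kernel C K k A f B \<longleftrightarrow>
     K \<in> C \<and> A \<in> C \<and> B \<in> C \<and> k \<in> Hom K A \<and> f \<in> Hom A B \<and>
     compm K f k = zerom K B \<and>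
     (\<forall>W\<in>C. \<forall>w\<in>Hom W A. compm W f w = zerom W B \<longrightarrow> (\<exists>!u. u \<in> Hom W K \<and> compm W k u = w))"

definition is_cokernel ::
  "'a monoid set \<Rightarrow> 'a monoid \<Rightarrow> ('a \<Rightarrow> 'a) \<Rightarrow> 'a monoid \<Rightarrow> ('a \<Rightarrow> 'a) \<Rightarrow> 'a monoid \<Rightarrow> bool" where
  "is_cokernel C K k A f B \<longleftrightarrow>
     K \<in> C \<and> A \<in> C \<and> B \<in> C \<and> k \<in> Hom K A \<and> f \<in> Hom A B \<and>
     compm K f k = zerom K B \<and>
     (\<forall>W\<in>C. \<forall>w\<in>Hom A W. compm K w k = zerom K W \<longrightarrow> (\<exists>!u. u \<in> Hom B W \<and> compm A u f = w))"

definition short_exact ::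
  "'a monoid set \<Rightarrow> 'a monoid \<Rightarrow> ('a \<Rightarrow> 'a) \<Rightarrow> 'a monoid \<Rightarrow> ('a \<Rightarrow> 'a) \<Rightarrow> 'a monoid \<Rightarrow> bool" where
  "short_exact C K k A f B \<longleftrightarrow> is_kernel C K k A f B \<and> is_cokernel C K k A f B"

definition split_short_exact ::
  "'a monoid set \<Rightarrow> 'a monoid \<Rightarrow> ('a \<Rightarrow> 'a) \<Rightarrow> 'a monoid \<Rightarrow> ('a \<Rightarrow> 'a) \<Rightarrow> ('a \<Rightarrow> 'a) \<Rightarrow> 'a monoid
    \<Rightarrow> bool" where
  "split_short_exact C K k A f s B \<longleftrightarrow>
     short_exact C K k A f B \<and> s \<in> Hom B A \<and> compm B f s = idm B"

definition full_replete_subcategory :: "'a monoid set \<Rightarrow> 'a monoid set \<Rightarrow> bool" where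
  "full_replete_subcategory C X \<longleftrightarrow> X \<subseteq> C \<and> (\<forall>G\<in>X. \<forall>H\<in>C. G \<cong> H \<longrightarrow> H \<in> X)"

text \<open>
  A functor between full subcategories is given by its object map \<open>Fo\<close> and its arrow map
  \<open>Fa\<close>; the latter takes the domain and codomain of the arrow as extra arguments.
\<close>

definition is_functor ::
  "'a monoid set \<Rightarrow> 'a monoid set \<Rightarrow> ('a monoid \<Rightarrow> 'a monoid)
    \<Rightarrow> ('a monoid \<Rightarrow> 'a monoid \<Rightarrow> ('a \<Rightarrow> 'a) \<Rightarrow> 'a \<Rightarrow> 'a) \<Rightarrow> bool" where
  "is_functor C X Fo Fa \<longleftrightarrow>
     (\<forall>G\<in>C. Fo G \<in> X) \<and>
     (\<forall>G\<in>C. \<forall>H\<in>C. \<forall>f\<in>Hom G H. Fa G H f \<in> Hom (Fo G) (Fo H)) \<and>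
     (\<forall>G\<in>C. Fa G G (idm G) = idm (Fo G)) \<and>
     (\<forall>G\<in>C. \<forall>H\<in>C. \<forall>L\<in>C. \<forall>f\<in>Hom G H. \<forall>g\<in>Hom H L.
        Fa G L (compm G g f) = compm (Fo G) (Fa H L g) (Fa G H f))"

text \<open>
  The functor is left adjoint to the inclusion of \<open>X\<close> into \<open>C\<close>, with unit \<open>\<eta>\<close>.
\<close>

definition is_reflection ::
  "'a monoid set \<Rightarrow> 'a monoid set \<Rightarrow> ('a monoid \<Rightarrow> 'a monoid)
    \<Rightarrow> ('a monoid \<Rightarrow> 'a monoid \<Rightarrow> ('a \<Rightarrow> 'a) \<Rightarrow> 'a \<Rightarrow> 'a) \<Rightarrow> ('a monoid \<Rightarrow> 'a \<Rightarrow> 'a) \<Rightarrow> bool" where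
  "is_reflection C X Fo Fa \<eta> \<longleftrightarrow>
     is_functor C X Fo Fa \<and>
     (\<forall>G\<in>C. \<eta> G \<in> Hom G (Fo G)) \<and>
     (\<forall>G\<in>C. \<forall>H\<in>C. \<forall>f\<in>Hom G H. compm G (Fa G H f) (\<eta> G) = compm G (\<eta> H) f) \<and>
     (\<forall>G\<in>C. \<forall>Y\<in>X. \<forall>f\<in>Hom G Y. \<exists>!g. g \<in> Hom (Fo G) Y \<and> compm G g (\<eta> G) = f)"

definition protoadditive ::
  "'a monoid set \<Rightarrow> 'a monoid set \<Rightarrow> ('a monoid \<Rightarrow> 'a monoid)
    \<Rightarrow> ('a monoid \<Rightarrow> 'a monoid \<Rightarrow> ('a \<Rightarrow> 'a) \<Rightarrow> 'a \<Rightarrow> 'a) \<Rightarrow> bool" where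
  "protoadditive C X Fo Fa \<longleftrightarrow>
     (\<forall>K A B k f s. split_short_exact C K k A f s B \<longrightarrow>
        split_short_exact X (Fo K) (Fa K A k) (Fo A) (Fa A B f) (Fa B A s) (Fo B))"

end

theory Submission
  imports Defs "HOL-Algebra.Free_Abelian_Groups" "HOL-Algebra.Weak_Morphisms"
begin

text \<open>
  Let \<open>F\<close> be a protoadditive reflection onto \<open>X\<close> with unit \<open>\<eta>\<close>, and suppose that \<open>X\<close> contains a
  nontrivial group \<open>Y\<close>.  It suffices to show that every \<open>\<eta> G : G \<rightarrow> F G\<close> is bijective, because \<open>X\<close>
  is replete.

  Protoadditivity enters in one way only.  The inclusion of \<open>X\<close> is a right adjoint, so kernels in
  \<open>X\<close> are injective maps.  Hence, if \<open>K\<close> is the kernel of a split epimorphism out of \<open>A\<close>, the map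
  \<open>F K \<rightarrow> F A\<close> is injective, and an element of \<open>K\<close> killed by \<open>\<eta> A\<close> is already killed by \<open>\<eta> K\<close>,
  that is, by every homomorphism from \<open>K\<close> to \<open>Y\<close>
  (\<open>hom_kills_unit_kernel_of_split_extension\<close>).

  This is contradicted by the following extension.  For a subgroup \<open>H\<close> of \<open>G\<close>, let \<open>G\<close> act on the
  free abelian group on the left cosets of \<open>H\<close>, let \<open>A\<close> be the semidirect product, \<open>s\<close> the
  canonical section, and \<open>d\<close> the basis vector at the coset \<open>H\<close>.  The commutator of \<open>s x\<close> and \<open>d\<close> is
  the difference of the basis vectors at \<open>x H\<close> and \<open>H\<close>.  It is trivial for \<open>x \<in> H\<close>; for \<open>x \<notin> H\<close>,
  reading off the coefficient at \<open>x H\<close> gives homomorphisms from the kernel that send it to any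
  prescribed element of \<open>Y\<close>.  So \<open>\<eta> A (s x)\<close> and \<open>\<eta> A d\<close> commute only if \<open>x \<in> H\<close>
  (\<open>unit_detects\<close>).

  \<^item> Injectivity: take \<open>H\<close> trivial.  If \<open>\<eta> G\<close> kills \<open>x\<close>, then by naturality \<open>\<eta> A\<close> kills \<open>s x\<close>,
    which therefore commutes with \<open>d\<close> after applying \<open>\<eta> A\<close>; so \<open>x = 1\<close>.

  \<^item> Surjectivity: apply the construction to the image \<open>H\<close> of \<open>\<eta> G\<close> in \<open>F G\<close>.  The section
    \<open>s\<close> and its conjugate by \<open>d\<close> agree on \<open>H\<close>.  Composed with \<open>\<eta> A\<close> they have a target in \<open>X\<close>, so they
    agree on all of \<open>F G\<close> by the universal property of \<open>\<eta> G\<close>; hence \<open>H\<close> is everything.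
\<close>

section \<open>Morphisms and split epimorphisms of groups\<close>

lemma HomD:
  assumes "f \<in> Hom G H"
  shows "f \<in> hom G H" "f \<in> extensional (carrier G)"
  using assms by (auto simp: Hom_def)

lemma Hom_closed: "f \<in> Hom G H \<Longrightarrow> x \<in> carrier G \<Longrightarrow> f x \<in> carrier H"
  by (auto simp: Hom_def hom_def)

lemma Hom_eqI:
  assumes "f \<in> Hom G H" "g \<in> Hom G H'" "\<And>x. x \<in> carrier G \<Longrightarrow> f x = g x"
  shows "f = g"
  using assms by (auto simp: Hom_def intro: extensionalityI)

lemma restrict_in_Hom:
  assumes "group G" "f \<in> hom G H"
  shows "restrict f (carrier G) \<in> Hom G H"
  using assms by (auto simp: Hom_def hom_def group.is_monoid monoid.m_closed Pi_iff)

lemma compm_apply [simp]: "x \<in> carrier G \<Longrightarrow> compm G g f x = g (f x)"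
  by (simp add: compm_def compose_def)

lemma zerom_apply [simp]: "x \<in> carrier G \<Longrightarrow> zerom G H x = \<one>\<^bsub>H\<^esub>"
  by (simp add: zerom_def)

lemma idm_apply [simp]: "x \<in> carrier G \<Longrightarrow> idm G x = x"
  by (simp add: idm_def)

lemma compm_in_Hom:
  assumes "group G" "f \<in> Hom G H" "g \<in> Hom H L"
  shows "compm G g f \<in> Hom G L"
  using assms by (auto simp: Hom_def compm_def intro: group.hom_compose)

lemma zerom_in_Hom:
  assumes "group G" "group H"
  shows "zerom G H \<in> Hom G H"
proof -
  have "(\<lambda>x. \<one>\<^bsub>H\<^esub>) \<in> hom G H"
    using assms by (auto simp: hom_def group.is_monoid)
  then show ?thesis
    using restrict_in_Hom[OF assms(1)] by (simp add: zerom_def)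
qed

lemma GrpD: "G \<in> Grp \<kappa> \<Longrightarrow> group G"
  by (simp add: Grp_def)

lemma subgroup_in_Grp:
  assumes "G \<in> Grp \<kappa>" "subgroup H G"
  shows "G\<lparr>carrier := H\<rparr> \<in> Grp \<kappa>"
proof -
  have "|H| \<le>o |carrier G|"
    using assms(2) by (simp add: subgroup.subset card_of_mono1)
  moreover have "group (G\<lparr>carrier := H\<rparr>)"
    using assms by (simp add: Grp_def subgroup.subgroup_is_group)
  ultimately show ?thesis
    using assms(1) ordLeq_ordLess_trans by (auto simp: Grp_def)
qed

abbreviation ker_group where
  "ker_group A B p \<equiv> A\<lparr>carrier := kernel A B p\<rparr>"

lemma kernel_is_subgroup:
  assumes "group A" "group B" "p \<in> hom A B"
  shows "subgroup (kernel A B p) A"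
  using assms by (simp add: group_hom.intro group_hom_axioms.intro group_hom.subgroup_kernel)

lemma inclusion_in_Hom:
  assumes "group G" "subgroup H G"
  shows "idm (G\<lparr>carrier := H\<rparr>) \<in> Hom (G\<lparr>carrier := H\<rparr>) G"
proof -
  have "(\<lambda>x. x) \<in> hom (G\<lparr>carrier := H\<rparr>) G"
    using subgroup.subset[OF assms(2)] by (auto simp: hom_def)
  then show ?thesis
    using restrict_in_Hom[OF subgroup.subgroup_is_group[OF assms(2,1)]] by (simp add: idm_def)
qed

text \<open>
  A split epimorphism is the cokernel of its kernel: a morphism \<open>w\<close> that vanishes on the kernel is
  determined by its restriction along the section, because \<open>a\<close> and \<open>s (p a)\<close> differ by an element of
  the kernel.
\<close>

lemma split_short_exact_kernel:
  assumes A: "A \<in> Grp \<kappa>" and B: "B \<in> Grp \<kappa>"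
    and p: "p \<in> Hom A B" and s: "s \<in> Hom B A" and ps: "\<And>b. b \<in> carrier B \<Longrightarrow> p (s b) = b"
  shows "split_short_exact (Grp \<kappa>) (ker_group A B p) (idm (ker_group A B p)) A p s B"
proof -
  let ?K = "ker_group A B p" and ?k = "idm (ker_group A B p)"
  interpret A: group A using A by (rule GrpD)
  interpret B: group B using B by (rule GrpD)
  interpret p: group_hom A B p
    using HomD(1)[OF p] by unfold_locales
  interpret s: group_hom B A s
    using HomD(1)[OF s] by unfold_locales
  have sub: "subgroup (kernel A B p) A" by (rule p.subgroup_kernel)
  have K: "?K \<in> Grp \<kappa>" using subgroup_in_Grp[OF A sub] .
  have k: "?k \<in> Hom ?K A" using inclusion_in_Hom[OF A.is_group sub] .
  have pk: "compm ?K p ?k = zerom ?K B"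
    by (rule Hom_eqI[OF compm_in_Hom[OF GrpD[OF K] k p] zerom_in_Hom[OF GrpD[OF K] B.is_group]])
      (simp add: kernel_def)
  have "is_kernel (Grp \<kappa>) ?K ?k A p B"
    unfolding is_kernel_def
  proof (intro conjI ballI impI)
    fix W w
    assume W: "W \<in> Grp \<kappa>" and w: "w \<in> Hom W A" and pw: "compm W p w = zerom W B"
    have wk: "w x \<in> kernel A B p" if "x \<in> carrier W" for x
      using fun_cong[OF pw, of x] that Hom_closed[OF w that] by (simp add: kernel_def)
    have wK: "w \<in> Hom W ?K"
      using wk w by (auto simp: Hom_def hom_def)
    show "\<exists>!u. u \<in> Hom W ?K \<and> compm W ?k u = w"
    proof (intro ex1I conjI)
      show "compm W ?k w = w"
        by (rule Hom_eqI[OF compm_in_Hom[OF GrpD[OF W] wK k] w]) (simp add: wk)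
      fix u assume u: "u \<in> Hom W ?K \<and> compm W ?k u = w"
      show "u = w"
      proof (rule Hom_eqI[OF conjunct1[OF u] w])
        fix x assume x: "x \<in> carrier W"
        then have "u x \<in> kernel A B p" using Hom_closed[OF conjunct1[OF u] x] by simp
        then show "u x = w x" using fun_cong[OF conjunct2[OF u], of x] x by simp
      qed
    qed (rule wK)
  qed (use A B K k p pk in auto)
  moreover have "is_cokernel (Grp \<kappa>) ?K ?k A p B"
    unfolding is_cokernel_def
  proof (intro conjI ballI impI)
    fix W w
    assume W: "W \<in> Grp \<kappa>" and w: "w \<in> Hom A W" and wk: "compm ?K w ?k = zerom ?K W"
    interpret W: group W using W by (rule GrpD)
    interpret w: group_hom A W w
      using HomD(1)[OF w] by unfold_locales
    have w_sp: "w (s (p a)) = w a" if a: "a \<in> carrier A" for a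
    proof -
      have "a \<otimes>\<^bsub>A\<^esub> inv\<^bsub>A\<^esub> s (p a) \<in> kernel A B p"
        using a by (simp add: kernel_def ps)
      then have "w (a \<otimes>\<^bsub>A\<^esub> inv\<^bsub>A\<^esub> s (p a)) = \<one>\<^bsub>W\<^esub>"
        using fun_cong[OF wk, of "a \<otimes>\<^bsub>A\<^esub> inv\<^bsub>A\<^esub> s (p a)"] by simp
      then have "w a \<otimes>\<^bsub>W\<^esub> inv\<^bsub>W\<^esub> w (s (p a)) = \<one>\<^bsub>W\<^esub>"
        using a by simp
      then show ?thesis
        using a by (metis W.inv_equality W.inv_inv W.inv_closed p.hom_closed s.hom_closed w.hom_closed)
    qed
    have ws: "compm B w s \<in> Hom B W"
      using compm_in_Hom[OF B.is_group s w] .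
    show "\<exists>!u. u \<in> Hom B W \<and> compm A u p = w"
    proof (intro ex1I conjI)
      show "compm A (compm B w s) p = w"
        by (rule Hom_eqI[OF compm_in_Hom[OF A.is_group p ws] w]) (simp add: w_sp)
      fix u assume u: "u \<in> Hom B W \<and> compm A u p = w"
      show "u = compm B w s"
      proof (rule Hom_eqI[OF conjunct1[OF u] ws])
        fix b assume "b \<in> carrier B"
        then show "u b = compm B w s b"
          using fun_cong[OF conjunct2[OF u], of "s b"] by (simp add: ps)
      qed
    qed (rule ws)
  qed (use A B K k p pk in auto)
  moreover have "compm B p s = idm B"
    by (rule Hom_eqI[OF compm_in_Hom[OF B.is_group s p]]) (auto simp: ps idm_def Hom_def hom_def)
  ultimately show ?thesis
    using s by (simp add: split_short_exact_def short_exact_def)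
qed

section \<open>Reflections and kernels\<close>

locale group_reflection =
  fixes \<kappa> :: "'k rel"
    and X :: "'a monoid set"
    and Fo :: "'a monoid \<Rightarrow> 'a monoid"
    and Fa :: "'a monoid \<Rightarrow> 'a monoid \<Rightarrow> ('a \<Rightarrow> 'a) \<Rightarrow> 'a \<Rightarrow> 'a"
    and \<eta> :: "'a monoid \<Rightarrow> 'a \<Rightarrow> 'a"
  assumes subcategory: "full_replete_subcategory (Grp \<kappa>) X"
    and reflection: "is_reflection (Grp \<kappa>) X Fo Fa \<eta>"
begin

lemma X_Grp: "Y \<in> X \<Longrightarrow> Y \<in> Grp \<kappa>"
  using subcategory by (auto simp: full_replete_subcategory_def)

lemma Fo_in_X: "G \<in> Grp \<kappa> \<Longrightarrow> Fo G \<in> X"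
  using reflection by (simp add: is_reflection_def is_functor_def)

lemma Fo_group: "G \<in> Grp \<kappa> \<Longrightarrow> group (Fo G)"
  using Fo_in_X X_Grp GrpD by blast

lemma Fa_in_Hom: "G \<in> Grp \<kappa> \<Longrightarrow> H \<in> Grp \<kappa> \<Longrightarrow> f \<in> Hom G H \<Longrightarrow> Fa G H f \<in> Hom (Fo G) (Fo H)"
  using reflection by (simp add: is_reflection_def is_functor_def)

lemma unit_in_Hom: "G \<in> Grp \<kappa> \<Longrightarrow> \<eta> G \<in> Hom G (Fo G)"
  using reflection by (simp add: is_reflection_def)

lemma unit_group_hom: "G \<in> Grp \<kappa> \<Longrightarrow> group_hom G (Fo G) (\<eta> G)"
  by (simp add: group_hom_def group_hom_axioms_def GrpD Fo_group HomD(1)[OF unit_in_Hom])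

lemma unit_natural:
  assumes "G \<in> Grp \<kappa>" "H \<in> Grp \<kappa>" "f \<in> Hom G H" "x \<in> carrier G"
  shows "Fa G H f (\<eta> G x) = \<eta> H (f x)"
proof -
  have "compm G (Fa G H f) (\<eta> G) = compm G (\<eta> H) f"
    using reflection assms by (simp add: is_reflection_def)
  from fun_cong[OF this, of x] show ?thesis using assms(4) by simp
qed

lemma unit_factor:
  assumes "G \<in> Grp \<kappa>" "Y \<in> X" "f \<in> Hom G Y"
  obtains g where "g \<in> Hom (Fo G) Y" "\<And>x. x \<in> carrier G \<Longrightarrow> g (\<eta> G x) = f x"
proof -
  have "\<exists>!g. g \<in> Hom (Fo G) Y \<and> compm G g (\<eta> G) = f"
    using reflection assms by (simp add: is_reflection_def)
  then obtain g where "g \<in> Hom (Fo G) Y" "compm G g (\<eta> G) = f" by blast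
  then show thesis using that by (metis compm_apply)
qed

lemma reflection_Hom_eqI:
  assumes G: "G \<in> Grp \<kappa>" and Y: "Y \<in> X" and f: "f \<in> Hom (Fo G) Y" and g: "g \<in> Hom (Fo G) Y"
    and eq: "\<And>x. x \<in> carrier G \<Longrightarrow> f (\<eta> G x) = g (\<eta> G x)"
  shows "f = g"
proof -
  have f\<eta>: "compm G f (\<eta> G) \<in> Hom G Y" and g\<eta>: "compm G g (\<eta> G) \<in> Hom G Y"
    using compm_in_Hom[OF GrpD[OF G] unit_in_Hom[OF G]] f g by auto
  have "\<exists>!h. h \<in> Hom (Fo G) Y \<and> compm G h (\<eta> G) = compm G g (\<eta> G)"
    using reflection G Y g\<eta> by (simp add: is_reflection_def)
  moreover have "compm G f (\<eta> G) = compm G g (\<eta> G)"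
    by (rule Hom_eqI[OF f\<eta> g\<eta>]) (simp add: eq)
  ultimately show ?thesis using f g by blast
qed

text \<open>
  The universal property of a kernel in \<open>X\<close> only speaks of test objects in \<open>X\<close>, and the subgroup
  \<open>N\<close> of elements killed by \<open>k\<close> need not be one.  But the inclusion of \<open>N\<close> into \<open>K\<close> factors through
  the reflection of \<open>N\<close>, and the factor \<open>u\<close> satisfies \<open>k u = 0\<close>, as this holds after composing with
  the unit.  Since \<open>k\<close> is monic in \<open>X\<close>, \<open>u\<close> is zero, hence so is the inclusion of \<open>N\<close>.
\<close>

lemma kernel_in_subcategory_injective:
  assumes ker: "is_kernel X K k A f B" and z: "z \<in> carrier K" and kz: "k z = \<one>\<^bsub>A\<^esub>"
  shows "z = \<one>\<^bsub>K\<^esub>"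
proof -
  have X: "K \<in> X" "A \<in> X" "B \<in> X" and k: "k \<in> Hom K A" and f: "f \<in> Hom A B"
    and univ: "\<And>W w. W \<in> X \<Longrightarrow> w \<in> Hom W A \<Longrightarrow> compm W f w = zerom W B \<Longrightarrow>
      \<exists>!u. u \<in> Hom W K \<and> compm W k u = w"
    using ker by (auto simp: is_kernel_def)
  note grp = GrpD[OF X_Grp[OF X(1)]] GrpD[OF X_Grp[OF X(2)]] GrpD[OF X_Grp[OF X(3)]]
  let ?N = "ker_group K A k"
  have sub: "subgroup (kernel K A k) K"
    using kernel_is_subgroup[OF grp(1,2) HomD(1)[OF k]] .
  have N: "?N \<in> Grp \<kappa>" using subgroup_in_Grp[OF X_Grp[OF X(1)] sub] .
  obtain u where u: "u \<in> Hom (Fo ?N) K" and u\<eta>: "\<And>x. x \<in> carrier ?N \<Longrightarrow> u (\<eta> ?N x) = idm ?N x"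
    using unit_factor[OF N X(1) inclusion_in_Hom[OF grp(1) sub]] by blast
  let ?W = "Fo ?N"
  have W: "?W \<in> X" "group ?W" using N by (auto simp: Fo_in_X Fo_group)
  have "compm ?W k u = zerom ?W A"
  proof (rule reflection_Hom_eqI[OF N X(2) compm_in_Hom[OF W(2) u k] zerom_in_Hom[OF W(2) grp(2)]])
    fix x assume x: "x \<in> carrier ?N"
    then have "\<eta> ?N x \<in> carrier ?W" using Hom_closed[OF unit_in_Hom[OF N]] by blast
    then show "compm ?W k u (\<eta> ?N x) = zerom ?W A (\<eta> ?N x)"
      using x u\<eta>[OF x] by (simp add: kernel_def)
  qed
  moreover have "compm ?W k (zerom ?W K) = zerom ?W A"
    by (rule Hom_eqI[OF compm_in_Hom[OF W(2) zerom_in_Hom[OF W(2) grp(1)] k]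
          zerom_in_Hom[OF W(2) grp(2)]])
      (simp add: hom_one[OF HomD(1)[OF k] grp(1,2)])
  moreover have "compm ?W f (zerom ?W A) = zerom ?W B"
    by (rule Hom_eqI[OF compm_in_Hom[OF W(2) zerom_in_Hom[OF W(2) grp(2)] f]
          zerom_in_Hom[OF W(2) grp(3)]])
      (simp add: hom_one[OF HomD(1)[OF f] grp(2,3)])
  ultimately have "u = zerom ?W K"
    using univ[OF W(1) zerom_in_Hom[OF W(2) grp(2)]] u zerom_in_Hom[OF W(2) grp(1)] by blast
  moreover have zN: "z \<in> carrier ?N" using z kz by (simp add: kernel_def)
  moreover have "\<eta> ?N z \<in> carrier ?W" using Hom_closed[OF unit_in_Hom[OF N] zN] .
  ultimately show ?thesis using u\<eta>[OF zN] by simp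
qed

lemma hom_kills_unit_kernel:
  assumes "G \<in> Grp \<kappa>" "Y \<in> X" "q \<in> hom G Y" "v \<in> carrier G" "\<eta> G v = \<one>\<^bsub>Fo G\<^esub>"
  shows "q v = \<one>\<^bsub>Y\<^esub>"
proof -
  obtain g where g: "g \<in> Hom (Fo G) Y"
    and g\<eta>: "\<And>x. x \<in> carrier G \<Longrightarrow> g (\<eta> G x) = restrict q (carrier G) x"
    using unit_factor[OF assms(1,2) restrict_in_Hom[OF GrpD[OF assms(1)] assms(3)]] by blast
  have "g \<one>\<^bsub>Fo G\<^esub> = \<one>\<^bsub>Y\<^esub>"
    using hom_one[OF HomD(1)[OF g] Fo_group[OF assms(1)] GrpD[OF X_Grp[OF assms(2)]]] .
  then show ?thesis using g\<eta>[OF assms(4)] assms(4,5) by simp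
qed

text \<open>
  The image under \<open>F\<close> of the inclusion of the kernel is a kernel in \<open>X\<close> and therefore injective.  By
  naturality it sends the unit of the kernel at \<open>v\<close> to \<open>\<eta> A v = 1\<close>, so the unit of the kernel kills
  \<open>v\<close>.
\<close>

lemma hom_kills_unit_kernel_of_split_extension:
  assumes proto: "protoadditive (Grp \<kappa>) X Fo Fa"
    and A: "A \<in> Grp \<kappa>" and B: "B \<in> Grp \<kappa>"
    and p: "p \<in> Hom A B" and s: "s \<in> Hom B A" and ps: "\<And>b. b \<in> carrier B \<Longrightarrow> p (s b) = b"
    and v: "v \<in> kernel A B p" and \<eta>v: "\<eta> A v = \<one>\<^bsub>Fo A\<^esub>"
    and Y: "Y \<in> X" and q: "q \<in> hom (ker_group A B p) Y"
  shows "q v = \<one>\<^bsub>Y\<^esub>"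
proof -
  let ?K = "ker_group A B p" and ?k = "idm (ker_group A B p)"
  have sub: "subgroup (kernel A B p) A"
    using kernel_is_subgroup[OF GrpD[OF A] GrpD[OF B] HomD(1)[OF p]] .
  have K: "?K \<in> Grp \<kappa>" using subgroup_in_Grp[OF A sub] .
  have k: "?k \<in> Hom ?K A" using inclusion_in_Hom[OF GrpD[OF A] sub] .
  have vK: "v \<in> carrier ?K" using v by simp
  have "split_short_exact X (Fo ?K) (Fa ?K A ?k) (Fo A) (Fa A B p) (Fa B A s) (Fo B)"
    using proto split_short_exact_kernel[OF A B p s ps] unfolding protoadditive_def by blast
  then have "is_kernel X (Fo ?K) (Fa ?K A ?k) (Fo A) (Fa A B p) (Fo B)"
    by (simp add: split_short_exact_def short_exact_def)
  moreover have "Fa ?K A ?k (\<eta> ?K v) = \<one>\<^bsub>Fo A\<^esub>"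
    using unit_natural[OF K A k vK] \<eta>v vK by simp
  ultimately have "\<eta> ?K v = \<one>\<^bsub>Fo ?K\<^esub>"
    using kernel_in_subcategory_injective Hom_closed[OF unit_in_Hom[OF K] vK] by blast
  then show ?thesis using hom_kills_unit_kernel[OF K Y q vK] by simp
qed

end

section \<open>A split extension that detects a subgroup\<close>

text \<open>
  The two properties of the semidirect product that the argument uses: the commutator of \<open>s x\<close> with
  the element \<open>d\<close> of the kernel is trivial on \<open>H\<close>, and off \<open>H\<close> it can be mapped to any element
  of any group.  This form is invariant under isomorphism of the middle group, so that the extension
  can be built on another type and carried over.
\<close>

definition detecting_extension ::
  "'a monoid \<Rightarrow> 'a set \<Rightarrow> 'b monoid \<Rightarrow> ('b \<Rightarrow> 'a) \<Rightarrow> ('a \<Rightarrow> 'b) \<Rightarrow> 'b \<Rightarrow> bool" where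
  "detecting_extension G H A p s d \<longleftrightarrow>
     group A \<and> p \<in> hom A G \<and> s \<in> hom G A \<and> (\<forall>x\<in>carrier G. p (s x) = x) \<and>
     d \<in> kernel A G p \<and>
     (\<forall>x\<in>H. s x \<otimes>\<^bsub>A\<^esub> d = d \<otimes>\<^bsub>A\<^esub> s x) \<and>
     (\<forall>x\<in>carrier G - H. \<forall>Y::'a monoid. group Y \<longrightarrow> (\<forall>y\<in>carrier Y.
        \<exists>q\<in>hom (ker_group A G p) Y.
          q (s x \<otimes>\<^bsub>A\<^esub> d \<otimes>\<^bsub>A\<^esub> inv\<^bsub>A\<^esub> s x \<otimes>\<^bsub>A\<^esub> inv\<^bsub>A\<^esub> d) = y))"

definition coset_action where
  "coset_action G x = frag_extend (\<lambda>C. frag_of (x <#\<^bsub>G\<^esub> C))"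

definition lcosets_of where
  "lcosets_of G H = (\<lambda>x. x <#\<^bsub>G\<^esub> H) ` carrier G"

text \<open>
  The semidirect product of the permutation module on the left cosets of \<open>H\<close> with \<open>G\<close>.
\<close>

definition coset_extension where
  "coset_extension G H =
     \<lparr>carrier = carrier (free_Abelian_group (lcosets_of G H)) \<times> carrier G,
      monoid.mult = (\<lambda>(m, x) (n, y). (m + coset_action G x n, x \<otimes>\<^bsub>G\<^esub> y)),
      one = (0, \<one>\<^bsub>G\<^esub>)\<rparr>"

lemma coset_extension_simps:
  "a \<in> carrier (coset_extension G H) \<longleftrightarrow>
     Poly_Mapping.keys (fst a) \<subseteq> lcosets_of G H \<and> snd a \<in> carrier G"
  "(m, x) \<otimes>\<^bsub>coset_extension G H\<^esub> (n, y) = (m + coset_action G x n, x \<otimes>\<^bsub>G\<^esub> y)"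
  "\<one>\<^bsub>coset_extension G H\<^esub> = (0, \<one>\<^bsub>G\<^esub>)"
  by (auto simp: coset_extension_def mem_Times_iff)

context
  fixes G :: "'a monoid" and H
  assumes G: "group G" and H: "subgroup H G"
begin

interpretation G: group G by (rule G)
interpretation H: subgroup H G by (rule H)

lemma lcosets_of_subset: "C \<in> lcosets_of G H \<Longrightarrow> C \<subseteq> carrier G"
  using G.l_coset_subset_G[OF H.subset] by (auto simp: lcosets_of_def)

lemma lcosets_of_translate:
  "C \<in> lcosets_of G H \<Longrightarrow> x \<in> carrier G \<Longrightarrow> x <#\<^bsub>G\<^esub> C \<in> lcosets_of G H"
  by (auto simp: lcosets_of_def G.lcos_m_assoc[OF H.subset])

lemma coset_action_closed:
  assumes "Poly_Mapping.keys n \<subseteq> lcosets_of G H" "x \<in> carrier G"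
  shows "Poly_Mapping.keys (coset_action G x n) \<subseteq> lcosets_of G H"
  unfolding coset_action_def
  using assms by (intro order_trans[OF keys_frag_extend]) (auto simp: keys_frag_of lcosets_of_translate)

lemma coset_action_add: "coset_action G x (m + n) = coset_action G x m + coset_action G x n"
  by (simp add: coset_action_def frag_extend_add)

lemma coset_action_one:
  assumes "Poly_Mapping.keys n \<subseteq> lcosets_of G H"
  shows "coset_action G \<one>\<^bsub>G\<^esub> n = n"
proof -
  have "coset_action G \<one>\<^bsub>G\<^esub> n = frag_extend frag_of n"
    unfolding coset_action_def
    by (rule frag_extend_eq) (use assms lcosets_of_subset G.lcos_mult_one in \<open>metis subsetD\<close>)
  then show ?thesis using frag_expansion by metis
qed

lemma coset_action_mult:
  assumes "Poly_Mapping.keys n \<subseteq> lcosets_of G H" "x \<in> carrier G" "y \<in> carrier G"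
  shows "coset_action G x (coset_action G y n) = coset_action G (x \<otimes>\<^bsub>G\<^esub> y) n"
proof -
  have "coset_action G x (coset_action G y n) = frag_extend (\<lambda>C. frag_of (x <#\<^bsub>G\<^esub> (y <#\<^bsub>G\<^esub> C))) n"
    using frag_extend_compose[of "\<lambda>C. frag_of (x <#\<^bsub>G\<^esub> C)" "\<lambda>C. y <#\<^bsub>G\<^esub> C" n]
    by (simp add: coset_action_def comp_def)
  also have "\<dots> = coset_action G (x \<otimes>\<^bsub>G\<^esub> y) n"
    unfolding coset_action_def
    by (rule frag_extend_eq) (use assms lcosets_of_subset G.lcos_m_assoc in \<open>metis subsetD\<close>)
  finally show ?thesis .
qed

lemma group_coset_extension: "group (coset_extension G H)"
proof (rule groupI)
  fix a b c assume a: "a \<in> carrier (coset_extension G H)" and b: "b \<in> carrier (coset_extension G H)"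
    and c: "c \<in> carrier (coset_extension G H)"
  then show "a \<otimes>\<^bsub>coset_extension G H\<^esub> b \<otimes>\<^bsub>coset_extension G H\<^esub> c =
      a \<otimes>\<^bsub>coset_extension G H\<^esub> (b \<otimes>\<^bsub>coset_extension G H\<^esub> c)"
    by (cases a; cases b; cases c)
      (simp add: coset_extension_simps coset_action_add coset_action_mult G.m_assoc add.assoc)
next
  fix a b assume "a \<in> carrier (coset_extension G H)" "b \<in> carrier (coset_extension G H)"
  then show "a \<otimes>\<^bsub>coset_extension G H\<^esub> b \<in> carrier (coset_extension G H)"
    by (cases a; cases b)
      (auto simp: coset_extension_simps
        intro!: order_trans[OF keys_add] Un_least coset_action_closed del: subsetI)
next
  show "\<one>\<^bsub>coset_extension G H\<^esub> \<in> carrier (coset_extension G H)"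
    by (simp add: coset_extension_simps)
next
  fix a assume a: "a \<in> carrier (coset_extension G H)"
  obtain m x where [simp]: "a = (m, x)" by (cases a)
  have m: "Poly_Mapping.keys m \<subseteq> lcosets_of G H" and x: "x \<in> carrier G"
    using a by (auto simp: coset_extension_simps)
  show "\<one>\<^bsub>coset_extension G H\<^esub> \<otimes>\<^bsub>coset_extension G H\<^esub> a = a"
    using m x by (simp add: coset_extension_simps coset_action_one)
  let ?b = "(- coset_action G (inv\<^bsub>G\<^esub> x) m, inv\<^bsub>G\<^esub> x)"
  have "?b \<in> carrier (coset_extension G H)" "?b \<otimes>\<^bsub>coset_extension G H\<^esub> a = \<one>\<^bsub>coset_extension G H\<^esub>"
    using m x coset_action_closed[OF m] by (auto simp: coset_extension_simps)
  then show "\<exists>b\<in>carrier (coset_extension G H). b \<otimes>\<^bsub>coset_extension G H\<^esub> a = \<one>\<^bsub>coset_extension G H\<^esub>"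
    by blast
qed

lemma subgroup_in_lcosets: "H \<in> lcosets_of G H"
  unfolding lcosets_of_def using G.lcos_mult_one[OF H.subset] by (metis G.one_closed image_eqI)

lemma l_coset_eq_self_iff:
  assumes "x \<in> carrier G"
  shows "x <#\<^bsub>G\<^esub> H = H \<longleftrightarrow> x \<in> H"
proof
  assume "x <#\<^bsub>G\<^esub> H = H"
  moreover have "x \<in> x <#\<^bsub>G\<^esub> H"
    using assms H.one_closed by (force simp: l_coset_def)
  ultimately show "x \<in> H" by simp
next
  assume "x \<in> H"
  then show "x <#\<^bsub>G\<^esub> H = H"
    using G.subgroup_mult_id[OF H] H.lcos_module_rev by (metis G G.l_repr_independence G.lcos_mult_one G.one_closed H H.subset)
qed

text \<open>
  On the kernel of the projection the group operation is addition of coefficient functions, so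
  \<open>y\<close> raised to the coefficient at \<open>x H\<close> is a homomorphism.  At the difference of the basis
  vectors at \<open>x H\<close> and \<open>H\<close> the exponent is \<open>1\<close>, provided that the two cosets are distinct.
\<close>

lemma detecting_coset_extension:
  "detecting_extension G H (coset_extension G H) snd (\<lambda>x. (0, x)) (frag_of H, \<one>\<^bsub>G\<^esub>)"
proof -
  let ?A = "coset_extension G H" and ?s = "\<lambda>x. (0, x)" and ?d = "(frag_of H, \<one>\<^bsub>G\<^esub>)"
  interpret A: group ?A by (rule group_coset_extension)
  have act: "coset_action G x (frag_of H) = frag_of (x <#\<^bsub>G\<^esub> H)" for x
    by (simp add: coset_action_def)
  have act0: "coset_action G x 0 = 0" for x
    by (simp add: coset_action_def)
  have d: "?d \<in> carrier ?A"
    by (simp add: coset_extension_simps subgroup_in_lcosets)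
  have s: "?s x \<in> carrier ?A" if "x \<in> carrier G" for x
    using that by (simp add: coset_extension_simps)
  have comm: "?s x \<otimes>\<^bsub>?A\<^esub> ?d \<otimes>\<^bsub>?A\<^esub> inv\<^bsub>?A\<^esub> ?s x \<otimes>\<^bsub>?A\<^esub> inv\<^bsub>?A\<^esub> ?d =
      (frag_of (x <#\<^bsub>G\<^esub> H) - frag_of H, \<one>\<^bsub>G\<^esub>)" if x: "x \<in> carrier G" for x
  proof -
    let ?v = "(frag_of (x <#\<^bsub>G\<^esub> H) - frag_of H, \<one>\<^bsub>G\<^esub>)"
    have v: "?v \<in> carrier ?A"
      using x subgroup_in_lcosets lcosets_of_translate
      by (auto simp: coset_extension_simps keys_frag_of dest!: subsetD[OF keys_diff])
    have "?v \<otimes>\<^bsub>?A\<^esub> ?d \<otimes>\<^bsub>?A\<^esub> ?s x = ?s x \<otimes>\<^bsub>?A\<^esub> ?d"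
      using x by (simp add: coset_extension_simps act act0 G.lcos_mult_one[OF H.subset])
    then show ?thesis
      using v d s[OF x] by (metis A.inv_solve_right' A.m_closed)
  qed
  show ?thesis
    unfolding detecting_extension_def
  proof (intro conjI ballI allI impI)
    show "group ?A" by (rule A.is_group)
    show "snd \<in> hom ?A G" "?s \<in> hom G ?A"
      by (auto simp: hom_def coset_extension_simps act0)
    show "?d \<in> kernel ?A G snd"
      using d by (simp add: kernel_def)
    show "?s x \<otimes>\<^bsub>?A\<^esub> ?d = ?d \<otimes>\<^bsub>?A\<^esub> ?s x" if "x \<in> H" for x
      using that l_coset_eq_self_iff[of x] H.mem_carrier[OF that] by (simp add: coset_extension_simps act act0)
  next
    fix x and Y :: "'a monoid" and y
    assume x: "x \<in> carrier G - H" and Y: "group Y" and y: "y \<in> carrier Y"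
    interpret Y: group Y by (rule Y)
    have ne: "x <#\<^bsub>G\<^esub> H \<noteq> H" using x l_coset_eq_self_iff by auto
    let ?q = "\<lambda>a. y [^]\<^bsub>Y\<^esub> Poly_Mapping.lookup (fst a) (x <#\<^bsub>G\<^esub> H)"
    have "?q \<in> hom (ker_group ?A G snd) Y"
      using y by (auto simp: hom_def kernel_def coset_extension_simps coset_action_one lookup_add Y.int_pow_mult)
    moreover have "?q (frag_of (x <#\<^bsub>G\<^esub> H) - frag_of H, \<one>\<^bsub>G\<^esub>) = y"
      using y ne by (simp add: lookup_minus)
    ultimately show "\<exists>q\<in>hom (ker_group ?A G snd) Y.
        q (?s x \<otimes>\<^bsub>?A\<^esub> ?d \<otimes>\<^bsub>?A\<^esub> inv\<^bsub>?A\<^esub> ?s x \<otimes>\<^bsub>?A\<^esub> inv\<^bsub>?A\<^esub> ?d) = y"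
      using comm x by (intro bexI[of _ ?q]) auto
  qed simp
qed

end


text \<open>
  An element of the permutation module is determined by finitely many pairs of a coset and an
  integer.  The factor of integers keeps the bound valid for finite \<open>G\<close>, where the module is
  countably infinite; uncountability of \<open>\<kappa>\<close> then absorbs it.
\<close>

lemma coset_extension_lepoll:
  assumes "H \<subseteq> carrier G" and "group G"
  shows "carrier (coset_extension G H) \<lesssim> (carrier G \<times> (UNIV :: int set)) \<times> carrier G"
proof -
  let ?S = "lcosets_of G H"
  have ne: "carrier G \<noteq> {}"
    using group.is_monoid[OF assms(2)] monoid.one_closed by blast
  have "carrier (free_Abelian_group ?S)
      \<lesssim> {f. f ` ?S \<subseteq> (UNIV :: int set) \<and> {x. f x \<noteq> 0} \<subseteq> ?S \<and> finite {x. f x \<noteq> 0}}"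
    unfolding lepoll_def
    by (rule exI[of _ Poly_Mapping.lookup])
      (auto simp: poly_mapping_eqI lookup_not_eq_zero_eq_in_keys inj_on_def)
  also have "\<dots> \<lesssim> Fpow (?S \<times> (UNIV :: int set))"
    by (rule lepoll_restricted_funspace)
  also have "\<dots> \<approx> ?S \<times> (UNIV :: int set)"
  proof (rule eqpoll_Fpow)
    show "infinite (?S \<times> (UNIV :: int set))"
      using ne by (auto simp: lcosets_of_def finite_cartesian_product_iff infinite_UNIV_int)
  qed
  also have "\<dots> \<lesssim> carrier G \<times> (UNIV :: int set)"
    unfolding lcosets_of_def by (intro times_lepoll_mono image_lepoll lepoll_refl)
  finally show ?thesis
    unfolding coset_extension_def by (simp add: times_lepoll_mono)
qed

lemma coset_extension_card:
  assumes \<kappa>: "Card_order \<kappa>" "natLeq <o \<kappa>" and G: "G \<in> Grp \<kappa>" and H: "H \<subseteq> carrier G"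
  shows "|carrier (coset_extension G H)| <o \<kappa>"
proof -
  have inf: "infinite (Field \<kappa>)"
    using \<kappa> by (metis Field_natLeq cinfinite_def cinfinite_mono infinite_UNIV_nat natLeq_cinfinite ordLess_imp_ordLeq)
  have "|UNIV :: int set| <o \<kappa>"
  proof -
    have "|UNIV :: int set| \<le>o |UNIV :: nat set|"
      using card_of_ordLeq[of "UNIV :: int set" "UNIV :: nat set"] inj_to_nat by blast
    then show ?thesis
      using \<kappa>(2) card_of_nat ordLeq_ordIso_trans ordLeq_ordLess_trans by blast
  qed
  moreover have "|carrier G| <o \<kappa>" using G by (simp add: Grp_def)
  ultimately have "|(carrier G \<times> (UNIV :: int set)) \<times> carrier G| <o \<kappa>"
    using inf \<kappa>(1) by (simp add: card_of_Times_ordLess_infinite_Field)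
  moreover have "|carrier (coset_extension G H)| \<le>o |(carrier G \<times> (UNIV :: int set)) \<times> carrier G|"
    using coset_extension_lepoll[OF H GrpD[OF G]] by (simp add: lepoll_def card_of_ordLeq)
  ultimately show ?thesis using ordLeq_ordLess_trans by blast
qed

lemma isomorphic_copy_in_Grp:
  fixes \<kappa> :: "'k rel" and A :: "'b monoid"
  assumes \<kappa>: "\<kappa> \<le>o cardSuc |UNIV :: 'a set|" and A: "group A" "|carrier A| <o \<kappa>"
  obtains A' :: "'a monoid" and h where "A' \<in> Grp \<kappa>" "h \<in> iso A A'"
proof -
  have "|carrier A| <o cardSuc |UNIV :: 'a set|"
    using A(2) \<kappa> ordLess_ordLeq_trans by blast
  then have "|carrier A| \<le>o |UNIV :: 'a set|"
    by (simp add: cardSuc_ordLeq_ordLess)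
  then obtain h :: "'b \<Rightarrow> 'a" where h: "inj_on h (carrier A)"
    by (auto simp: card_of_ordLeq[symmetric])
  have "|h ` carrier A| \<le>o |carrier A|" by (rule card_of_image)
  then have "|carrier (image_group h A)| <o \<kappa>"
    unfolding image_group_carrier using A(2) by (rule ordLeq_ordLess_trans)
  then have "image_group h A \<in> Grp \<kappa>"
    using group.inj_imp_image_group_is_group[OF A(1) h] by (simp add: Grp_def)
  then show thesis using that inj_imp_image_group_iso[OF h] by blast
qed

lemma detecting_extension_iso:
  fixes G :: "'a monoid" and A :: "'b monoid" and A' :: "'c monoid"
  assumes ext: "detecting_extension G H A p s d" and G: "group G" and A': "group A'"
    and H: "H \<subseteq> carrier G" and h: "h \<in> iso A A'"
  shows "detecting_extension G H A' (restrict (p \<circ> inv_into (carrier A) h) (carrier A'))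
    (restrict (h \<circ> s) (carrier G)) (h d)"
proof -
  let ?g = "inv_into (carrier A) h"
  let ?p = "restrict (p \<circ> ?g) (carrier A')" and ?s = "restrict (h \<circ> s) (carrier G)"
  have A: "group A" and p: "p \<in> hom A G" and s: "s \<in> hom G A"
    and ps: "\<And>x. x \<in> carrier G \<Longrightarrow> p (s x) = x" and d: "d \<in> kernel A G p"
    and comm: "\<And>x. x \<in> H \<Longrightarrow> s x \<otimes>\<^bsub>A\<^esub> d = d \<otimes>\<^bsub>A\<^esub> s x"
    and det: "\<And>x (Y :: 'a monoid) y. x \<in> carrier G - H \<Longrightarrow> group Y \<Longrightarrow> y \<in> carrier Y \<Longrightarrow>
        \<exists>q\<in>hom (ker_group A G p) Y.
          q (s x \<otimes>\<^bsub>A\<^esub> d \<otimes>\<^bsub>A\<^esub> inv\<^bsub>A\<^esub> s x \<otimes>\<^bsub>A\<^esub> inv\<^bsub>A\<^esub> d) = y"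
    using ext unfolding detecting_extension_def by auto
  interpret A: group A by (rule A)
  interpret G: group G by (rule G)
  interpret A': group A' by (rule A')
  have h_hom: "h \<in> hom A A'" and h_bij: "bij_betw h (carrier A) (carrier A')"
    using h by (auto simp: iso_def)
  interpret h: group_hom A A' h by unfold_locales (rule h_hom)
  have g: "?g \<in> hom A' A" using A.iso_set_sym[OF h] by (simp add: iso_def)
  have gh: "?g (h a) = a" if "a \<in> carrier A" for a
    using h_bij that by (simp add: bij_betw_inv_into_left)
  have sA: "s x \<in> carrier A" if "x \<in> carrier G" for x
    using hom_in_carrier[OF s that] .
  have dA: "d \<in> carrier A" and pd: "p d = \<one>\<^bsub>G\<^esub>" using d by (auto simp: kernel_def)
  show ?thesis
    unfolding detecting_extension_def
  proof (intro conjI ballI allI impI)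
    show "?p \<in> hom A' G"
      by (rule A'.hom_restrict[OF Group.hom_compose[OF g p]]) simp
    show "?s \<in> hom G A'"
      by (rule G.hom_restrict[OF Group.hom_compose[OF s h_hom]]) simp
    show "?p (?s x) = x" if "x \<in> carrier G" for x
      using that sA gh ps by simp
    show "h d \<in> kernel A' G ?p"
      using dA pd gh by (simp add: kernel_def)
    show "?s x \<otimes>\<^bsub>A'\<^esub> h d = h d \<otimes>\<^bsub>A'\<^esub> ?s x" if x: "x \<in> H" for x
    proof -
      have xG: "x \<in> carrier G" using x H by blast
      have "h (s x \<otimes>\<^bsub>A\<^esub> d) = h (d \<otimes>\<^bsub>A\<^esub> s x)" by (simp add: comm[OF x])
      then show ?thesis using xG sA dA by simp
    qed
  next
    fix x and Y :: "'a monoid" and y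
    assume x: "x \<in> carrier G - H" and Y: "group Y" and y: "y \<in> carrier Y"
    let ?v = "s x \<otimes>\<^bsub>A\<^esub> d \<otimes>\<^bsub>A\<^esub> inv\<^bsub>A\<^esub> s x \<otimes>\<^bsub>A\<^esub> inv\<^bsub>A\<^esub> d"
    obtain q where q: "q \<in> hom (ker_group A G p) Y" and qv: "q ?v = y"
      using det[OF x Y y] by blast
    have "?g \<in> hom (ker_group A' G ?p) (ker_group A G p)"
      using g by (auto simp: hom_def kernel_def)
    then have qg: "q \<circ> ?g \<in> hom (ker_group A' G ?p) Y"
      using q by (rule Group.hom_compose)
    have "?s x \<otimes>\<^bsub>A'\<^esub> h d \<otimes>\<^bsub>A'\<^esub> inv\<^bsub>A'\<^esub> ?s x \<otimes>\<^bsub>A'\<^esub> inv\<^bsub>A'\<^esub> h d = h ?v"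
      using x sA dA by simp
    moreover have "?g (h ?v) = ?v" using x sA dA by (intro gh) simp
    ultimately show "\<exists>q\<in>hom (ker_group A' G ?p) Y.
        q (?s x \<otimes>\<^bsub>A'\<^esub> h d \<otimes>\<^bsub>A'\<^esub> inv\<^bsub>A'\<^esub> ?s x \<otimes>\<^bsub>A'\<^esub> inv\<^bsub>A'\<^esub> h d) = y"
      using qg qv by (intro bexI[of _ "q \<circ> ?g"]) simp_all
  qed (rule A')
qed

lemma detecting_extension_in_Grp:
  fixes \<kappa> :: "'k rel" and G :: "'a monoid"
  assumes \<kappa>: "Card_order \<kappa>" "natLeq <o \<kappa>" "\<kappa> \<le>o cardSuc |UNIV :: 'a set|"
    and G: "G \<in> Grp \<kappa>" and H: "subgroup H G"
  obtains A :: "'a monoid" and p s d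
  where "A \<in> Grp \<kappa>" "p \<in> Hom A G" "s \<in> Hom G A" "detecting_extension G H A p s d"
proof -
  note HG = subgroup.subset[OF H]
  obtain A :: "'a monoid" and h where A: "A \<in> Grp \<kappa>" and h: "h \<in> iso (coset_extension G H) A"
    using isomorphic_copy_in_Grp[OF \<kappa>(3) group_coset_extension[OF GrpD[OF G] H]
        coset_extension_card[OF \<kappa>(1,2) G HG]] .
  note ext = detecting_extension_iso[OF detecting_coset_extension[OF GrpD[OF G] H]
      GrpD[OF G] GrpD[OF A] HG h]
  show thesis
    by (rule that[OF A _ _ ext]) (use ext in \<open>auto simp: detecting_extension_def Hom_def\<close>)
qed

section \<open>Units of protoadditive reflections\<close>

locale protoadditive_reflection = group_reflection \<kappa> X Fo Fa \<eta>
  for \<kappa> :: "'k rel"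
    and X :: "'a monoid set"
    and Fo :: "'a monoid \<Rightarrow> 'a monoid"
    and Fa :: "'a monoid \<Rightarrow> 'a monoid \<Rightarrow> ('a \<Rightarrow> 'a) \<Rightarrow> 'a \<Rightarrow> 'a"
    and \<eta> :: "'a monoid \<Rightarrow> 'a \<Rightarrow> 'a" +
  assumes cardinal: "Card_order \<kappa>" "natLeq <o \<kappa>" "\<kappa> \<le>o cardSuc |UNIV :: 'a set|"
    and proto: "protoadditive (Grp \<kappa>) X Fo Fa"
    and nontrivial: "\<exists>Y\<in>X. \<not> trivial_group Y"
begin

text \<open>
  The commutator of \<open>s x\<close> and \<open>d\<close> lies in the kernel of the projection and is killed by \<open>\<eta> A\<close>, hence
  by every homomorphism from that kernel to a nontrivial group of \<open>X\<close>.  For \<open>x \<notin> H\<close> some such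
  homomorphism does not kill it.
\<close>

lemma unit_detects:
  assumes G: "G \<in> Grp \<kappa>" and A: "A \<in> Grp \<kappa>" and p: "p \<in> Hom A G" and s: "s \<in> Hom G A"
    and ext: "detecting_extension G H A p s d" and x: "x \<in> carrier G"
    and comm: "\<eta> A (s x) \<otimes>\<^bsub>Fo A\<^esub> \<eta> A d = \<eta> A d \<otimes>\<^bsub>Fo A\<^esub> \<eta> A (s x)"
  shows "x \<in> H"
proof (rule ccontr)
  assume "x \<notin> H"
  obtain Y where Y: "Y \<in> X" "\<not> trivial_group Y" using nontrivial by blast
  interpret Y: group Y using GrpD[OF X_Grp[OF Y(1)]] .
  obtain y where y: "y \<in> carrier Y" "y \<noteq> \<one>\<^bsub>Y\<^esub>"
    using Y(2) Y.is_group Y.one_closed unfolding trivial_group_def by blast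
  interpret A: group A using GrpD[OF A] .
  interpret \<eta>: group_hom A "Fo A" "\<eta> A" using unit_group_hom[OF A] .
  interpret p: group_hom A G p
    by (simp add: group_hom_def group_hom_axioms_def GrpD[OF G] HomD(1)[OF p])
  let ?v = "s x \<otimes>\<^bsub>A\<^esub> d \<otimes>\<^bsub>A\<^esub> inv\<^bsub>A\<^esub> s x \<otimes>\<^bsub>A\<^esub> inv\<^bsub>A\<^esub> d"
  have ps: "\<And>b. b \<in> carrier G \<Longrightarrow> p (s b) = b" and d: "d \<in> kernel A G p"
    using ext by (auto simp: detecting_extension_def)
  obtain q where q: "q \<in> hom (ker_group A G p) Y" and qv: "q ?v = y"
    using ext x \<open>x \<notin> H\<close> Y.is_group y(1) unfolding detecting_extension_def by blast
  have sx: "s x \<in> carrier A" using Hom_closed[OF s x] .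
  have dA: "d \<in> carrier A" and pd: "p d = \<one>\<^bsub>G\<^esub>" using d by (auto simp: kernel_def)
  have v: "?v \<in> kernel A G p"
    using sx dA by (simp add: kernel_def ps[OF x] pd x)
  have "\<eta> A ?v = \<one>\<^bsub>Fo A\<^esub>"
    using sx dA by (simp add: comm \<eta>.H.m_assoc)
  then have "q ?v = \<one>\<^bsub>Y\<^esub>"
    using hom_kills_unit_kernel_of_split_extension[OF proto A G p s ps v _ Y(1) q] by blast
  then show False using qv y(2) by simp
qed

text \<open>
  With \<open>H\<close> trivial: if \<open>\<eta> G\<close> kills \<open>x\<close>, then \<open>\<eta> A\<close> kills \<open>s x\<close> by naturality, and the identity
  commutes with everything.
\<close>

lemma unit_injective:
  assumes G: "G \<in> Grp \<kappa>"
  shows "inj_on (\<eta> G) (carrier G)"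
proof -
  interpret G: group G using GrpD[OF G] .
  interpret \<eta>G: group_hom G "Fo G" "\<eta> G" using unit_group_hom[OF G] .
  obtain A p s d where A: "A \<in> Grp \<kappa>" and p: "p \<in> Hom A G" and s: "s \<in> Hom G A"
    and ext: "detecting_extension G {\<one>\<^bsub>G\<^esub>} A p s d"
    using detecting_extension_in_Grp[OF cardinal G G.triv_subgroup] .
  interpret \<eta>: group_hom A "Fo A" "\<eta> A" using unit_group_hom[OF A] .
  have d: "d \<in> carrier A" using ext by (auto simp: detecting_extension_def kernel_def)
  have "x \<in> {\<one>\<^bsub>G\<^esub>}" if x: "x \<in> carrier G" and \<eta>x: "\<eta> G x = \<one>\<^bsub>Fo G\<^esub>" for x
  proof (rule unit_detects[OF G A p s ext x])
    have "\<eta> A (s x) = \<one>\<^bsub>Fo A\<^esub>"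
      using unit_natural[OF G A s x] \<eta>x
        hom_one[OF HomD(1)[OF Fa_in_Hom[OF G A s]] Fo_group[OF G] Fo_group[OF A]] by simp
    then show "\<eta> A (s x) \<otimes>\<^bsub>Fo A\<^esub> \<eta> A d = \<eta> A d \<otimes>\<^bsub>Fo A\<^esub> \<eta> A (s x)"
      using d by simp
  qed
  then show ?thesis
    by (intro \<eta>G.inj_on_one_iff[THEN iffD2]) auto
qed

text \<open>
  The homomorphisms \<open>s\<close> and \<open>t\<close>, the conjugate of \<open>s\<close> by \<open>d\<close>, agree on the image of \<open>\<eta> G\<close>.  Followed
  by \<open>\<eta> A\<close> they become morphisms from \<open>F G\<close> into an object of \<open>X\<close> that agree on this image, so they are
  equal everywhere.  This says that \<open>\<eta> A (s x)\<close> and \<open>\<eta> A d\<close> commute for every \<open>x\<close> in \<open>F G\<close>.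
\<close>

lemma unit_surjective:
  assumes G: "G \<in> Grp \<kappa>"
  shows "\<eta> G ` carrier G = carrier (Fo G)"
proof -
  have FG: "Fo G \<in> Grp \<kappa>" using Fo_in_X[OF G] X_Grp by blast
  interpret \<eta>G: group_hom G "Fo G" "\<eta> G" using unit_group_hom[OF G] .
  obtain A p s d where A: "A \<in> Grp \<kappa>" and p: "p \<in> Hom A (Fo G)" and s: "s \<in> Hom (Fo G) A"
    and ext: "detecting_extension (Fo G) (\<eta> G ` carrier G) A p s d"
    using detecting_extension_in_Grp[OF cardinal FG \<eta>G.img_is_subgroup] .
  interpret A: group A using GrpD[OF A] .
  interpret \<eta>: group_hom A "Fo A" "\<eta> A" using unit_group_hom[OF A] .
  have d: "d \<in> carrier A" using ext by (auto simp: detecting_extension_def kernel_def)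
  have sA: "s x \<in> carrier A" if "x \<in> carrier (Fo G)" for x using Hom_closed[OF s that] .
  let ?t = "\<lambda>x\<in>carrier (Fo G). d \<otimes>\<^bsub>A\<^esub> s x \<otimes>\<^bsub>A\<^esub> inv\<^bsub>A\<^esub> d"
  have "(\<lambda>x. d \<otimes>\<^bsub>A\<^esub> s x \<otimes>\<^bsub>A\<^esub> inv\<^bsub>A\<^esub> d) \<in> hom (Fo G) A"
  proof (rule homI)
    fix x y assume xy: "x \<in> carrier (Fo G)" "y \<in> carrier (Fo G)"
    have "inv\<^bsub>A\<^esub> d \<otimes>\<^bsub>A\<^esub> (d \<otimes>\<^bsub>A\<^esub> z) = z" if "z \<in> carrier A" for z
      using d that by (simp add: A.m_assoc[symmetric])
    then show "d \<otimes>\<^bsub>A\<^esub> s (x \<otimes>\<^bsub>Fo G\<^esub> y) \<otimes>\<^bsub>A\<^esub> inv\<^bsub>A\<^esub> d =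
        d \<otimes>\<^bsub>A\<^esub> s x \<otimes>\<^bsub>A\<^esub> inv\<^bsub>A\<^esub> d \<otimes>\<^bsub>A\<^esub> (d \<otimes>\<^bsub>A\<^esub> s y \<otimes>\<^bsub>A\<^esub> inv\<^bsub>A\<^esub> d)"
      using xy sA d by (simp add: hom_mult[OF HomD(1)[OF s]] A.m_assoc)
  qed (use d sA in auto)
  then have t: "?t \<in> Hom (Fo G) A" by (rule restrict_in_Hom[OF Fo_group[OF G]])
  have st: "compm (Fo G) (\<eta> A) s = compm (Fo G) (\<eta> A) ?t"
  proof (rule reflection_Hom_eqI[OF G Fo_in_X[OF A]])
    fix x assume x: "x \<in> carrier G"
    let ?y = "\<eta> G x"
    have "s ?y \<otimes>\<^bsub>A\<^esub> d = d \<otimes>\<^bsub>A\<^esub> s ?y"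
      using ext x by (simp add: detecting_extension_def)
    then have "d \<otimes>\<^bsub>A\<^esub> s ?y \<otimes>\<^bsub>A\<^esub> inv\<^bsub>A\<^esub> d = s ?y"
      using x sA d by (metis A.inv_solve_right' A.m_closed \<eta>G.hom_closed)
    then show "compm (Fo G) (\<eta> A) s ?y = compm (Fo G) (\<eta> A) ?t ?y" using x by simp
  qed (use compm_in_Hom[OF Fo_group[OF G]] s t unit_in_Hom[OF A] in blast)+
  have "x \<in> \<eta> G ` carrier G" if x: "x \<in> carrier (Fo G)" for x
  proof (rule unit_detects[OF FG A p s ext x])
    have "\<eta> A (s x) = \<eta> A d \<otimes>\<^bsub>Fo A\<^esub> \<eta> A (s x) \<otimes>\<^bsub>Fo A\<^esub> inv\<^bsub>Fo A\<^esub> \<eta> A d"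
      using fun_cong[OF st, of x] x sA d by simp
    then show "\<eta> A (s x) \<otimes>\<^bsub>Fo A\<^esub> \<eta> A d = \<eta> A d \<otimes>\<^bsub>Fo A\<^esub> \<eta> A (s x)"
      using x sA d by (metis \<eta>.H.inv_solve_right \<eta>.H.m_closed \<eta>.hom_closed)
  qed
  then show ?thesis by auto
qed

lemma subcategory_eq_Grp: "X = Grp \<kappa>"
proof -
  have "G \<in> X" if G: "G \<in> Grp \<kappa>" for G
  proof -
    have "\<eta> G \<in> iso G (Fo G)"
      using unit_in_Hom[OF G] unit_injective[OF G] unit_surjective[OF G]
      by (simp add: iso_iff Hom_def)
    then have "Fo G \<cong> G"
      using group.iso_sym[OF GrpD[OF G]] by (auto simp: is_iso_def)
    then show ?thesis
      using subcategory Fo_in_X[OF G] G unfolding full_replete_subcategory_def by blast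
  qed
  then show ?thesis using X_Grp by blast
qed

end

theorem theorem3p1:
  fixes \<kappa> :: "'k rel"
    and X :: "'a monoid set"
    and Fo :: "'a monoid \<Rightarrow> 'a monoid"
    and Fa :: "'a monoid \<Rightarrow> 'a monoid \<Rightarrow> ('a \<Rightarrow> 'a) \<Rightarrow> 'a \<Rightarrow> 'a"
    and \<eta> :: "'a monoid \<Rightarrow> 'a \<Rightarrow> 'a"
  assumes "Card_order \<kappa>" and "natLeq <o \<kappa>" and "\<kappa> \<le>o cardSuc |UNIV :: 'a set|"
    and "full_replete_subcategory (Grp \<kappa>) X"
    and "is_reflection (Grp \<kappa>) X Fo Fa \<eta>"
    and "protoadditive (Grp \<kappa>) X Fo Fa"
  shows "X = Grp \<kappa> \<or> (\<forall>G\<in>X. trivial_group G)"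
proof (rule disjCI)
  assume "\<not> (\<forall>G\<in>X. trivial_group G)"
  then interpret protoadditive_reflection \<kappa> X Fo Fa \<eta>
    using assms by unfold_locales auto
  show "X = Grp \<kappa>" by (rule subcategory_eq_Grp)
qed

end
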